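(* Let $r,s\in SO(3)$ and $u,w\in\mathbb{R}^3$, let $r_1,r_2,r_3$ and $s_1,s_2,s_3$ be the column vectors of $r$ and $s$, and set $t_i=-r_i\otimes w+u\otimes s_i$ for $i=1,2,3$. Let $a_i$ be the classical adjoint (adjugate) of the $3\times3$ matrix $t_i$. Then for distinct $i,j\in\{1,2,3\}$, $$t_i a_j t_i=t_j a_i t_j.$$
   Context: $x\otimes y$ denotes the $3\times 3$ matrix $xy^{t}$ for column vectors $x,y\in\mathbb{R}^3$, and juxtaposition of matrices is matrix multiplication. The classical adjoint (adjugate) of a matrix is the transpose of its matrix of cofactors. The tensor $t=-r\otimes w+u\otimes s\in(\mathbb{R}^3)^{\otimes3}$ is the general Euclidean trifocal tensor, and $t_1,t_2,t_3$ are its three slices with respect to the middle tensor factor. *)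

theory Defs
  imports Complex_Main "Jordan_Normal_Form.Determinant"
begin

text \<open>Indices of the library's matrices and vectors start at 0, so the columns
  \<open>r_1, r_2, r_3\<close> of a 3-by-3 matrix are \<open>col r 0\<close>, \<open>col r 1\<close>, \<open>col r 2\<close>.\<close>

text \<open>The library's \<open>orthogonal_mat\<close> only asks that the columns be nonzero and pairwise
  orthogonal, not orthonormal, hence the explicit equation here.\<close>

definition SO :: "nat \<Rightarrow> real mat set" where
  "SO n = {A \<in> carrier_mat n n. transpose_mat A * A = 1\<^sub>m n \<and> det A = 1}"

text \<open>\<open>outer_prod x y\<close> is \<open>x y^t\<close>; the column vector \<open>x\<close> is
  the transpose of the one-row matrix of \<open>x\<close>.\<close>

definition outer_prod :: "real vec \<Rightarrow> real vec \<Rightarrow> real mat" where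
  "outer_prod x y = transpose_mat (mat_of_row x) * mat_of_row y"

lemma dim_outer_prod [simp]:
  "dim_row (outer_prod x y) = dim_vec x" "dim_col (outer_prod x y) = dim_vec y"
  by (simp_all only: outer_prod_def index_mult_mat index_transpose_mat mat_of_row_dim)

lemma outer_prod_carrier [simp]:
  assumes "x \<in> carrier_vec m" "y \<in> carrier_vec n"
  shows "outer_prod x y \<in> carrier_mat m n"
  using assms by (intro carrier_matI) (simp_all only: dim_outer_prod carrier_vecD)

lemma outer_prod_index [simp]:
  assumes "i < dim_vec x" "j < dim_vec y"
  shows "outer_prod x y $$ (i, j) = x $ i * y $ j"
  using assms unfolding outer_prod_def mat_of_row_def by (simp add: scalar_prod_def)

end

theory Submission
  imports Defs
begin

text \<open>Each \<open>t_k\<close> is a sum of two rank-one matrices, so its adjugate is the rank-one matrix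
  \<open>(w \<times> s_k) (u \<times> r_k)^t\<close>. As \<open>w\<close> is orthogonal to \<open>w \<times> s_j\<close> and \<open>u\<close> to \<open>u \<times> r_j\<close>, the product
  \<open>t_i a_j t_i\<close> collapses to \<open>[s_i, w, s_j] [r_i, r_j, u] u w^t\<close>, with brackets denoting scalar
  triple products. Exchanging \<open>i\<close> and \<open>j\<close> changes the sign of both brackets.\<close>

text \<open>Shifting indices cyclically modulo 3 covers all three coordinates with one formula and
  builds in the signs.\<close>

definition cross_prod :: "real vec \<Rightarrow> real vec \<Rightarrow> real vec" where
  "cross_prod x y = vec 3 (\<lambda>k.
     x $ ((k + 1) mod 3) * y $ ((k + 2) mod 3) - x $ ((k + 2) mod 3) * y $ ((k + 1) mod 3))"

lemma cross_prod_carrier [simp]: "cross_prod x y \<in> carrier_vec 3"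
  by (simp add: cross_prod_def)

lemma dim_cross_prod [simp]: "dim_vec (cross_prod x y) = 3"
  by (simp add: cross_prod_def)

lemma cross_prod_index [simp]:
  "cross_prod x y $ 0 = x $ 1 * y $ 2 - x $ 2 * y $ 1"
  "cross_prod x y $ Suc 0 = x $ 2 * y $ 0 - x $ 0 * y $ 2"
  "cross_prod x y $ 2 = x $ 0 * y $ 1 - x $ 1 * y $ 0"
  by (simp_all add: cross_prod_def numeral_2_eq_2)

lemma scalar_prod_3:
  assumes "y \<in> carrier_vec 3"
  shows "x \<bullet> y = x $ 0 * y $ 0 + x $ 1 * y $ 1 + x $ 2 * y $ 2"
  using assms by (simp add: scalar_prod_def numeral_3_eq_3 numeral_2_eq_2)

lemma scalar_prod_cross_prod_self:
  "x \<bullet> cross_prod x y = 0"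
  by (simp add: scalar_prod_3 algebra_simps)

text \<open>Both sides are 3-by-3 determinants that differ by exchanging the outer two vectors; the
  middle one stays fixed, as \<open>w\<close> and \<open>u\<close> do when \<open>i\<close> and
  \<open>j\<close> are swapped.\<close>

lemma triple_prod_antisym:
  "x \<bullet> cross_prod y z = - (z \<bullet> cross_prod y x)"
  by (simp add: scalar_prod_3 algebra_simps)

lemma mult_outer_prod:
  assumes "A \<in> carrier_mat m n" "x \<in> carrier_vec n"
  shows "A * outer_prod x y = outer_prod (A *\<^sub>v x) y"
  using assms
  by (intro eq_matI) (simp_all add: scalar_prod_def sum_distrib_left mult_ac)

lemma outer_prod_mult:
  assumes "A \<in> carrier_mat m n" "y \<in> carrier_vec m"
  shows "outer_prod x y * A = outer_prod x (transpose_mat A *\<^sub>v y)"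
  using assms
  by (intro eq_matI) (simp_all add: scalar_prod_def sum_distrib_left mult_ac)

lemma outer_prod_smult:
  "outer_prod (c \<cdot>\<^sub>v x) (d \<cdot>\<^sub>v y) = (c * d) \<cdot>\<^sub>m outer_prod x y"
  by (intro eq_matI) simp_all

lemma det_2:
  fixes A :: "'a :: comm_ring_1 mat"
  assumes "A \<in> carrier_mat 2 2"
  shows "det A = A $$ (0, 0) * A $$ (1, 1) - A $$ (0, 1) * A $$ (1, 0)"
proof -
  have "det A = (\<Sum>j<2. A $$ (0, j) * cofactor A 0 j)"
    using assms by (intro laplace_expansion_row) simp_all
  also have "\<dots> = A $$ (0, 0) * A $$ (1, 1) - A $$ (0, 1) * A $$ (1, 0)"
    using assms by (simp add: numeral_2_eq_2 cofactor_def det_single mat_delete_def)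
  finally show ?thesis .
qed

text \<open>The matrix is the product of the 3-by-2 matrix with columns \<open>-x\<close>,
  \<open>z\<close> and the transpose of the one with columns \<open>y\<close>, \<open>v\<close>. By
  Cauchy-Binet its 2-by-2 minors are products of minors of these factors, that is, of cross product
  coordinates. The sign of \<open>-x\<close> turns \<open>x\<close>, \<open>z\<close> into
  \<open>z\<close>, \<open>x\<close>, and the adjugate's transposition puts the \<open>y\<close>,
  \<open>v\<close> factor on the left. The proof checks the nine entries directly.\<close>

lemma adj_mat_outer_prod_add:
  assumes "x \<in> carrier_vec 3" "y \<in> carrier_vec 3" "z \<in> carrier_vec 3" "v \<in> carrier_vec 3"
  shows "adj_mat (- outer_prod x y + outer_prod z v) = outer_prod (cross_prod y v) (cross_prod z x)"
    (is "adj_mat ?A = ?B")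
proof (rule eq_matI)
  fix i j
  assume "i < dim_row ?B" "j < dim_col ?B"
  then have "i \<in> {0, 1, 2}" "j \<in> {0, 1, 2}" by auto
  then show "adj_mat ?A $$ (i, j) = ?B $$ (i, j)"
    using assms
    by (auto simp: adj_mat_def cofactor_def mat_delete_def det_2 algebra_simps
        simp flip: numeral_2_eq_2)
qed (use assms in \<open>simp_all add: adj_mat_def\<close>)

lemma trifocal_mult_vec:
  assumes "x \<in> carrier_vec n" "y \<in> carrier_vec n" "z \<in> carrier_vec n" "v \<in> carrier_vec n"
    "q \<in> carrier_vec n"
  shows "(- outer_prod x y + outer_prod z v) *\<^sub>v q = - (y \<bullet> q) \<cdot>\<^sub>v x + (v \<bullet> q) \<cdot>\<^sub>v z"
  using assms
  by (intro eq_vecI)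
    (simp_all add: scalar_prod_def sum_distrib_left sum.distrib sum_subtractf algebra_simps)

text \<open>Transposition preserves the shape of the matrix, so \<open>trifocal_mult_vec\<close>
  also computes the action from the other side.\<close>

lemma transpose_trifocal:
  assumes "x \<in> carrier_vec n" "y \<in> carrier_vec n" "z \<in> carrier_vec n" "v \<in> carrier_vec n"
  shows "transpose_mat (- outer_prod x y + outer_prod z v) = - outer_prod y x + outer_prod v z"
  using assms by (intro eq_matI) simp_all

lemma trifocal_mult_adj_mult:
  assumes "x \<in> carrier_vec 3" "y \<in> carrier_vec 3" "x' \<in> carrier_vec 3" "y' \<in> carrier_vec 3"
    and "u \<in> carrier_vec 3" "w \<in> carrier_vec 3"
  defines "T \<equiv> - outer_prod x w + outer_prod u y"
  shows "T * adj_mat (- outer_prod x' w + outer_prod u y') * T =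
    (- (y \<bullet> cross_prod w y') * (x \<bullet> cross_prod u x')) \<cdot>\<^sub>m outer_prod u w"
proof -
  let ?q = "cross_prod w y'" and ?p = "cross_prod u x'"
  have T: "T \<in> carrier_mat 3 3"
    using assms by (simp add: T_def)
  \<comment> \<open>The coefficient of \<open>x\<close> is \<open>-(w \<bullet> ?q)\<close>, which
    vanishes.\<close>
  have Tq: "T *\<^sub>v ?q = (y \<bullet> ?q) \<cdot>\<^sub>v u"
    using assms unfolding T_def
    by (subst trifocal_mult_vec[of _ 3])
      (auto simp: scalar_prod_cross_prod_self intro!: eq_vecI)
  \<comment> \<open>Here the coefficient of \<open>y\<close> is \<open>u \<bullet> ?p = 0\<close>;
    the surviving term carries the minus sign.\<close>
  have Tp: "transpose_mat T *\<^sub>v ?p = (- (x \<bullet> ?p)) \<cdot>\<^sub>v w"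
    using assms unfolding T_def
    by (subst transpose_trifocal[of _ 3], simp_all, subst trifocal_mult_vec[of _ 3])
      (auto simp: scalar_prod_cross_prod_self intro!: eq_vecI)
  have "T * adj_mat (- outer_prod x' w + outer_prod u y') * T = T * outer_prod ?q ?p * T"
    using assms by (simp only: adj_mat_outer_prod_add)
  also have "\<dots> = outer_prod (T *\<^sub>v ?q) (transpose_mat T *\<^sub>v ?p)"
    by (simp only: mult_outer_prod[OF T] outer_prod_mult[OF T] cross_prod_carrier)
  finally show ?thesis
    by (simp only: Tq Tp outer_prod_smult mult_minus_left mult_minus_right)
qed

theorem corollary51:
  fixes r s :: "real mat" and u w :: "real vec"
    and t a :: "nat \<Rightarrow> real mat" and i j :: nat
  assumes "r \<in> SO 3" and "s \<in> SO 3"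
    and "u \<in> carrier_vec 3" and "w \<in> carrier_vec 3"
    and "\<And>k. k < 3 \<Longrightarrow> t k = - outer_prod (col r k) w + outer_prod u (col s k)"
    and "\<And>k. k < 3 \<Longrightarrow> a k = adj_mat (t k)"
    and "i < 3" and "j < 3" and "i \<noteq> j"
  shows "t i * a j * t i = t j * a i * t j"
proof -
  have col: "col r k \<in> carrier_vec 3" "col s k \<in> carrier_vec 3" for k
    using assms(1,2) by (auto simp: SO_def intro!: carrier_vecI)
  \<comment> \<open>Stated for general \<open>k\<close>, \<open>l\<close> so that it serves both
    orders of \<open>i\<close> and \<open>j\<close>; the matrix factor is the same for both, leaving
    only scalars to compare.\<close>
  have product: "t k * a l * t k =
      (- (col s k \<bullet> cross_prod w (col s l)) * (col r k \<bullet> cross_prod u (col r l))) \<cdot>\<^sub>m outer_prod u w"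
    if "k < 3" "l < 3" for k l
    using that assms(3-6) col by (simp only: trifocal_mult_adj_mult)
  show ?thesis
    using triple_prod_antisym[of "col s i" w "col s j"] triple_prod_antisym[of "col r i" u "col r j"]
    by (simp add: product assms(7,8))
qed

end
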